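(* Consider a power network with constant power loads as described in the context, with buses $1,\dots,M$ being PQ buses, buses $M+1,\dots,N-1$ PV buses and bus $N$ the reference bus. For every order $k\ge1$, the order-$k$ differential transformation of the full nonlinear power flow system $0=g(y(t),\lambda(t))$ (that is, the system of all transformed equations (T-P), (T-Q), (T-V), (T-E), (T-F) of the context) satisfies (takes the form of) the formally linear equation $$0=\mathbf{A}_{gy}\mathbf{Y}(k)+\mathbf{A}_{g\lambda}\Lambda(k)+\mathbf{B}_g,\qquad \mathbf{Y}(k)=[E_1(k),F_1(k),\dots,E_N(k),F_N(k)]^T,$$ in which the matrices depend only on the power series coefficients of orders $0$ to $k-1$ of $y$ and $\lambda$ (and on the network data), and are given by $$\mathbf{A}_{gy}=\begin{bmatrix}\mathbf{A}_{y,PQ}\\ \mathbf{A}_{y,PV}\\ \mathbf{A}_{y,REF}\end{bmatrix},\quad \mathbf{A}_{g\lambda}=\begin{bmatrix}\mathbf{A}_{\lambda,PQ}\\ \mathbf{A}_{\lambda,PV}\\ \mathbf{A}_{\lambda,REF}\end{bmatrix},\quad \mathbf{B}_g=\begin{bmatrix}\mathbf{B}_{PQ}\\ \mathbf{B}_{PV}\\ \mathbf{B}_{REF}\end{bmatrix},$$ $$\mathbf{A}_{y,PQ}=\begin{bmatrix}\mathbf{a}_{P,1}\\ \mathbf{a}_{Q,1}\\ \vdots\\ \mathbf{a}_{P,M}\\ \mathbf{a}_{Q,M}\end{bmatrix},\quad \mathbf{A}_{\lambda,PQ}=-\begin{bmatrix}\Delta p_1\\ \Delta q_1\\ \vdots\\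 \Delta p_M\\ \Delta q_M\end{bmatrix},\quad \mathbf{B}_{PQ}=\begin{bmatrix}\varepsilon_1\\ \mu_1\\ \vdots\\ \varepsilon_M\\ \mu_M\end{bmatrix},$$ $$\mathbf{A}_{y,PV}=\begin{bmatrix}\mathbf{a}_{P,M+1}\\ \mathbf{a}_{V,M+1}\\ \vdots\\ \mathbf{a}_{P,N-1}\\ \mathbf{a}_{V,N-1}\end{bmatrix},\quad \mathbf{A}_{\lambda,PV}=-\begin{bmatrix}\Delta p_{M+1}\\ 0\\ \vdots\\ \Delta p_{N-1}\\ 0\end{bmatrix},\quad \mathbf{B}_{PV}=\begin{bmatrix}\varepsilon_{M+1}\\ \varsigma_{M+1}\\ \vdots\\ \varepsilon_{N-1}\\ \varsigma_{N-1}\end{bmatrix},$$ $$\mathbf{A}_{y,REF}=\begin{bmatrix}\mathbf{a}_{E,N}\\ \mathbf{a}_{F,N}\end{bmatrix},\quad \mathbf{A}_{\lambda,REF}=\begin{bmatrix}0\\0\end{bmatrix},\quad \mathbf{B}_{REF}=\begin{bmatrix}-e_N^{sp}\rho(k)\\ -f_N^{sp}\rho(k)\end{bmatrix},$$ with the row vectors $\mathbf{a}_{P,i},\mathbf{a}_{Q,i},\mathbf{a}_{V,i},\mathbf{a}_{E,i},\mathbf{a}_{F,i}$ and scalars $\varepsilon_i,\mu_i,\varsigma_i$ defined in the context.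
   Context: Differential transformation (DT): for a real function $x(t)$, infinitely differentiable near $t=0$, its DT is the sequence of power series coefficients $X(k)=\frac{1}{k!}\frac{d^kx}{dt^k}(0)$, $k\ge 0$. Notation: $X(k)\otimes Y(k)=\sum_{m=0}^{k}X(m)Y(k-m)$. $\rho$ is the DT of the constant function $1$: $\rho(0)=1$, $\rho(k)=0$ for $k\ge1$. Empty sums are $0$. Network: $N$ buses; $\Omega_{PQ}=\{1,\dots,M\}$, $\Omega_{PV}=\{M+1,\dots,N-1\}$, $\Omega_{REF}=\{N\}$. Real numbers $g_{ij},b_{ij}$ are the real and imaginary parts of the entries of the bus admittance matrix; $e_i(t),f_i(t)$ are the real and imaginary parts of the voltage phasor of bus $i$, collected in $y(t)$; $\lambda(t)$ is the loading parameter; $\Delta p_i,\Delta q_i,p_i^{sp},q_i^{sp},v_i^{sp},e_i^{sp},f_i^{sp}$ are given real constants. DTs of $e_i,f_i,\lambda$ are $E_i(k),F_i(k),\Lambda(k)$. Power flow system $0=g(y,\lambda)$ (constant power load; sums over $j=1,\dots,N$): $p_i^{sp}=-\lambda\Delta p_i+\sum_j g_{ij}(e_ie_j+f_if_j)+\sum_j b_{ij}(f_ie_j-e_if_j)$ for $i\in\Omega_{PQ}\cup\Omega_{PV}$; $q_i^{sp}=-\lambda\Delta q_i-\sum_j b_{ij}(e_ie_j+f_if_j)+\sum_j g_{ij}(f_ie_j-e_if_j)$ for $i\in\Omega_{PQ}$; $(v_i^{sp})^2=e_i^2+f_i^2$ for $i\in\Omega_{PV}$; $e_i^{sp}=e_i$,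 $f_i^{sp}=f_i$ for $i\in\Omega_{REF}$. Transformed (DT) equations of order $k$: (T-P) $p_i^{sp}\rho(k)=-\Delta p_i\Lambda(k)+\sum_j g_{ij}(E_i(k)\otimes E_j(k)+F_i(k)\otimes F_j(k))+\sum_j b_{ij}(F_i(k)\otimes E_j(k)-E_i(k)\otimes F_j(k))$, $i\in\Omega_{PQ}\cup\Omega_{PV}$; (T-Q) $q_i^{sp}\rho(k)=-\Delta q_i\Lambda(k)-\sum_j b_{ij}(E_i(k)\otimes E_j(k)+F_i(k)\otimes F_j(k))+\sum_j g_{ij}(F_i(k)\otimes E_j(k)-E_i(k)\otimes F_j(k))$, $i\in\Omega_{PQ}$; (T-V) $(v_i^{sp})^2\rho(k)=E_i(k)\otimes E_i(k)+F_i(k)\otimes F_i(k)$, $i\in\Omega_{PV}$; (T-E) $e_i^{sp}\rho(k)=E_i(k)$ and (T-F) $f_i^{sp}\rho(k)=F_i(k)$, $i\in\Omega_{REF}$. Coefficients (row vectors in $\mathbb{R}^{1\times2N}$, columns ordered as in $\mathbf{Y}(k)$): $\mathbf{a}_{P,i}=[\alpha_{i1},\beta_{i1},\dots,\alpha_{iN},\beta_{iN}]$ with, for $j\ne i$, $\alpha_{ij}=g_{ij}E_i(0)+b_{ij}F_i(0)$, $\beta_{ij}=g_{ij}F_i(0)-b_{ij}E_i(0)$, and $\alpha_{ii}=\sum_{j=1}^N(g_{ij}E_j(0)-b_{ij}F_j(0))+g_{ii}E_i(0)+b_{ii}F_i(0)$, $\beta_{ii}=\sum_{j=1}^N(b_{ij}E_j(0)+g_{ij}F_j(0))-b_{ii}E_i(0)+g_{ii}F_i(0)$.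 $\mathbf{a}_{Q,i}=[\phi_{i1},\psi_{i1},\dots,\phi_{iN},\psi_{iN}]$ with, for $j\ne i$, $\phi_{ij}=-b_{ij}E_i(0)+g_{ij}F_i(0)$, $\psi_{ij}=-b_{ij}F_i(0)-g_{ij}E_i(0)$, and $\phi_{ii}=-\sum_{j=1}^N(b_{ij}E_j(0)+g_{ij}F_j(0))-b_{ii}E_i(0)+g_{ii}F_i(0)$, $\psi_{ii}=\sum_{j=1}^N(g_{ij}E_j(0)-b_{ij}F_j(0))-g_{ii}E_i(0)-b_{ii}F_i(0)$. $\mathbf{a}_{V,i}$ has entries $2E_i(0)$, $2F_i(0)$ in the positions of $E_i(k)$, $F_i(k)$ and zeros elsewhere; $\mathbf{a}_{E,i}$ (resp. $\mathbf{a}_{F,i}$) has entry $1$ in the position of $E_i(k)$ (resp. $F_i(k)$) and zeros elsewhere. With $c_{ij}=\sum_{m=1}^{k-1}E_i(m)E_j(k-m)+\sum_{m=1}^{k-1}F_i(m)F_j(k-m)$ and $d_{ij}=\sum_{m=1}^{k-1}F_i(m)E_j(k-m)-\sum_{m=1}^{k-1}E_i(m)F_j(k-m)$: $\varepsilon_i=\sum_j g_{ij}c_{ij}+\sum_j b_{ij}d_{ij}-p_i^{sp}\rho(k)$, $\mu_i=-\sum_j b_{ij}c_{ij}+\sum_j g_{ij}d_{ij}-q_i^{sp}\rho(k)$, $\varsigma_i=c_{ii}-(v_i^{sp})^2\rho(k)$. *)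

theory Defs
  imports "HOL-Analysis.Derivative" "Jordan_Normal_Form.Matrix"
begin

text \<open>
  \<open>HOL-Analysis\<close> and \<open>Jordan_Normal_Form\<close> both use \<open>$\<close> for vector components; here it
  always means the latter. All vectors and matrices are those of \<open>Jordan_Normal_Form\<close>.
\<close>

unbundle no vec_syntax

definition smooth_near_0 :: "(real \<Rightarrow> real) \<Rightarrow> bool" where
  "smooth_near_0 x \<longleftrightarrow>
     (\<exists>r>0. \<forall>n t. \<bar>t\<bar> < r \<longrightarrow> (deriv ^^ n) x differentiable (at t))"

text \<open>The differential transform: \<open>dt x\<close> is the sequence of Taylor coefficients of \<open>x\<close> at 0.\<close>

definition dt :: "(real \<Rightarrow> real) \<Rightarrow> nat \<Rightarrow> real" where
  "dt x k = (deriv ^^ k) x 0 / fact k"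

definition dt_conv :: "(nat \<Rightarrow> real) \<Rightarrow> (nat \<Rightarrow> real) \<Rightarrow> nat \<Rightarrow> real" (infixl \<open>\<star>\<close> 70) where
  "(X \<star> Y) k = (\<Sum>m=0..k. X m * Y (k - m))"

text \<open>The differential transform of the constant function 1.\<close>

definition rho :: "nat \<Rightarrow> real" where
  "rho k = (if k = 0 then 1 else 0)"

text \<open>
  Buses are numbered from 1: buses 1, ..., \<open>nPQ\<close> are PQ buses, bus \<open>nbus\<close> is the reference
  bus and those in between are PV buses. The bus admittance matrix has entries
  \<open>gY i j + \<i> bY i j\<close>. The fields \<open>dp\<close>, \<open>dq\<close> are the load directions
  $\Delta p$, $\Delta q$, and the suffix \<open>sp\<close> marks specified values.
\<close>

record network =
  nbus :: nat
  nPQ :: nat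
  gY :: "nat \<Rightarrow> nat \<Rightarrow> real"
  bY :: "nat \<Rightarrow> nat \<Rightarrow> real"
  dp :: "nat \<Rightarrow> real"
  dq :: "nat \<Rightarrow> real"
  psp :: "nat \<Rightarrow> real"
  qsp :: "nat \<Rightarrow> real"
  vsp :: "nat \<Rightarrow> real"
  esp :: "nat \<Rightarrow> real"
  fsp :: "nat \<Rightarrow> real"

definition all_buses :: "network \<Rightarrow> nat list" where
  "all_buses nw = [1..<Suc (nbus nw)]"

definition pq_buses :: "network \<Rightarrow> nat list" where
  "pq_buses nw = [1..<Suc (nPQ nw)]"

definition pv_buses :: "network \<Rightarrow> nat list" where
  "pv_buses nw = [Suc (nPQ nw)..<nbus nw]"

definition ref_buses :: "network \<Rightarrow> nat list" where
  "ref_buses nw = [nbus nw]"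

text \<open>For a list of buses \<open>[i, j, ...]\<close> this is \<open>[u i, v i, u j, v j, ...]\<close>.\<close>

definition interleave :: "nat list \<Rightarrow> (nat \<Rightarrow> 'a) \<Rightarrow> (nat \<Rightarrow> 'a) \<Rightarrow> 'a list" where
  "interleave is u v = concat (map (\<lambda>i. [u i, v i]) is)"


section \<open>The power flow system\<close>

text \<open>
  The components of $g(y,\lambda)$ at one instant: \<open>e i\<close>, \<open>f i\<close>, \<open>l\<close> are the values of
  the voltage components and of the loading parameter. Each component is the right-hand side
  minus the left-hand side (the specified value) of the corresponding power flow equation.
\<close>

definition g_P :: "network \<Rightarrow> (nat \<Rightarrow> real) \<Rightarrow> (nat \<Rightarrow> real) \<Rightarrow> real \<Rightarrow> nat \<Rightarrow> real" where
  "g_P nw e f l i =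
     - l * dp nw i
     + (\<Sum>j=1..nbus nw. gY nw i j * (e i * e j + f i * f j))
     + (\<Sum>j=1..nbus nw. bY nw i j * (f i * e j - e i * f j))
     - psp nw i"

definition g_Q :: "network \<Rightarrow> (nat \<Rightarrow> real) \<Rightarrow> (nat \<Rightarrow> real) \<Rightarrow> real \<Rightarrow> nat \<Rightarrow> real" where
  "g_Q nw e f l i =
     - l * dq nw i
     - (\<Sum>j=1..nbus nw. bY nw i j * (e i * e j + f i * f j))
     + (\<Sum>j=1..nbus nw. gY nw i j * (f i * e j - e i * f j))
     - qsp nw i"

definition g_V :: "network \<Rightarrow> (nat \<Rightarrow> real) \<Rightarrow> (nat \<Rightarrow> real) \<Rightarrow> nat \<Rightarrow> real" where
  "g_V nw e f i = (e i)\<^sup>2 + (f i)\<^sup>2 - (vsp nw i)\<^sup>2"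

definition power_flow_map ::
    "network \<Rightarrow> (nat \<Rightarrow> real) \<Rightarrow> (nat \<Rightarrow> real) \<Rightarrow> real \<Rightarrow> real vec" where
  "power_flow_map nw e f l = vec_of_list
     (interleave (pq_buses nw) (g_P nw e f l) (g_Q nw e f l)
      @ interleave (pv_buses nw) (g_P nw e f l) (g_V nw e f)
      @ interleave (ref_buses nw) (\<lambda>i. e i - esp nw i) (\<lambda>i. f i - fsp nw i))"


section \<open>The transformed equations\<close>

text \<open>
  From here on \<open>E i k\<close>, \<open>F i k\<close>, \<open>L k\<close> are the order-\<open>k\<close> coefficients of
  $e_i$, $f_i$, $\lambda$.
\<close>

definition transformed_P ::
    "network \<Rightarrow> (nat \<Rightarrow> nat \<Rightarrow> real) \<Rightarrow> (nat \<Rightarrow> nat \<Rightarrow> real) \<Rightarrow> (nat \<Rightarrow> real) \<Rightarrow> nat \<Rightarrow> nat \<Rightarrow> bool" where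
  "transformed_P nw E F L k i \<longleftrightarrow>
     psp nw i * rho k =
       - dp nw i * L k
       + (\<Sum>j=1..nbus nw. gY nw i j * ((E i \<star> E j) k + (F i \<star> F j) k))
       + (\<Sum>j=1..nbus nw. bY nw i j * ((F i \<star> E j) k - (E i \<star> F j) k))"

definition transformed_Q ::
    "network \<Rightarrow> (nat \<Rightarrow> nat \<Rightarrow> real) \<Rightarrow> (nat \<Rightarrow> nat \<Rightarrow> real) \<Rightarrow> (nat \<Rightarrow> real) \<Rightarrow> nat \<Rightarrow> nat \<Rightarrow> bool" where
  "transformed_Q nw E F L k i \<longleftrightarrow>
     qsp nw i * rho k =
       - dq nw i * L k
       - (\<Sum>j=1..nbus nw. bY nw i j * ((E i \<star> E j) k + (F i \<star> F j) k))
       + (\<Sum>j=1..nbus nw. gY nw i j * ((F i \<star> E j) k - (E i \<star> F j) k))"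

definition transformed_V ::
    "network \<Rightarrow> (nat \<Rightarrow> nat \<Rightarrow> real) \<Rightarrow> (nat \<Rightarrow> nat \<Rightarrow> real) \<Rightarrow> nat \<Rightarrow> nat \<Rightarrow> bool" where
  "transformed_V nw E F k i \<longleftrightarrow>
     (vsp nw i)\<^sup>2 * rho k = (E i \<star> E i) k + (F i \<star> F i) k"

definition transformed_system ::
    "network \<Rightarrow> (nat \<Rightarrow> nat \<Rightarrow> real) \<Rightarrow> (nat \<Rightarrow> nat \<Rightarrow> real) \<Rightarrow> (nat \<Rightarrow> real) \<Rightarrow> nat \<Rightarrow> bool" where
  "transformed_system nw E F L k \<longleftrightarrow>
     (\<forall>i \<in> set (pq_buses nw) \<union> set (pv_buses nw). transformed_P nw E F L k i) \<and>
     (\<forall>i \<in> set (pq_buses nw). transformed_Q nw E F L k i) \<and>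
     (\<forall>i \<in> set (pv_buses nw). transformed_V nw E F k i) \<and>
     (\<forall>i \<in> set (ref_buses nw). esp nw i * rho k = E i k \<and> fsp nw i * rho k = F i k)"


section \<open>The matrices of the linear form\<close>

definition Y_vec ::
    "network \<Rightarrow> (nat \<Rightarrow> nat \<Rightarrow> real) \<Rightarrow> (nat \<Rightarrow> nat \<Rightarrow> real) \<Rightarrow> nat \<Rightarrow> real vec" where
  "Y_vec nw E F k = vec_of_list (interleave (all_buses nw) (\<lambda>i. E i k) (\<lambda>i. F i k))"

definition alpha :: "network \<Rightarrow> (nat \<Rightarrow> nat \<Rightarrow> real) \<Rightarrow> (nat \<Rightarrow> nat \<Rightarrow> real) \<Rightarrow> nat \<Rightarrow> nat \<Rightarrow> real" where
  "alpha nw E F i j =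
     (if j = i
      then (\<Sum>n=1..nbus nw. gY nw i n * E n 0 - bY nw i n * F n 0)
           + gY nw i i * E i 0 + bY nw i i * F i 0
      else gY nw i j * E i 0 + bY nw i j * F i 0)"

definition beta :: "network \<Rightarrow> (nat \<Rightarrow> nat \<Rightarrow> real) \<Rightarrow> (nat \<Rightarrow> nat \<Rightarrow> real) \<Rightarrow> nat \<Rightarrow> nat \<Rightarrow> real" where
  "beta nw E F i j =
     (if j = i
      then (\<Sum>n=1..nbus nw. bY nw i n * E n 0 + gY nw i n * F n 0)
           - bY nw i i * E i 0 + gY nw i i * F i 0
      else gY nw i j * F i 0 - bY nw i j * E i 0)"

definition phi :: "network \<Rightarrow> (nat \<Rightarrow> nat \<Rightarrow> real) \<Rightarrow> (nat \<Rightarrow> nat \<Rightarrow> real) \<Rightarrow> nat \<Rightarrow> nat \<Rightarrow> real" where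
  "phi nw E F i j =
     (if j = i
      then - (\<Sum>n=1..nbus nw. bY nw i n * E n 0 + gY nw i n * F n 0)
           - bY nw i i * E i 0 + gY nw i i * F i 0
      else - bY nw i j * E i 0 + gY nw i j * F i 0)"

definition psi :: "network \<Rightarrow> (nat \<Rightarrow> nat \<Rightarrow> real) \<Rightarrow> (nat \<Rightarrow> nat \<Rightarrow> real) \<Rightarrow> nat \<Rightarrow> nat \<Rightarrow> real" where
  "psi nw E F i j =
     (if j = i
      then (\<Sum>n=1..nbus nw. gY nw i n * E n 0 - bY nw i n * F n 0)
           - gY nw i i * E i 0 - bY nw i i * F i 0
      else - bY nw i j * F i 0 - gY nw i j * E i 0)"

definition a_P :: "network \<Rightarrow> (nat \<Rightarrow> nat \<Rightarrow> real) \<Rightarrow> (nat \<Rightarrow> nat \<Rightarrow> real) \<Rightarrow> nat \<Rightarrow> real vec" where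
  "a_P nw E F i = vec_of_list (interleave (all_buses nw) (alpha nw E F i) (beta nw E F i))"

definition a_Q :: "network \<Rightarrow> (nat \<Rightarrow> nat \<Rightarrow> real) \<Rightarrow> (nat \<Rightarrow> nat \<Rightarrow> real) \<Rightarrow> nat \<Rightarrow> real vec" where
  "a_Q nw E F i = vec_of_list (interleave (all_buses nw) (phi nw E F i) (psi nw E F i))"

definition a_V :: "network \<Rightarrow> (nat \<Rightarrow> nat \<Rightarrow> real) \<Rightarrow> (nat \<Rightarrow> nat \<Rightarrow> real) \<Rightarrow> nat \<Rightarrow> real vec" where
  "a_V nw E F i = vec_of_list (interleave (all_buses nw)
     (\<lambda>j. if j = i then 2 * E i 0 else 0) (\<lambda>j. if j = i then 2 * F i 0 else 0))"

definition a_E :: "network \<Rightarrow> nat \<Rightarrow> real vec" where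
  "a_E nw i = vec_of_list (interleave (all_buses nw) (\<lambda>j. if j = i then 1 else 0) (\<lambda>j. 0))"

definition a_F :: "network \<Rightarrow> nat \<Rightarrow> real vec" where
  "a_F nw i = vec_of_list (interleave (all_buses nw) (\<lambda>j. 0) (\<lambda>j. if j = i then 1 else 0))"

definition c_coef :: "(nat \<Rightarrow> nat \<Rightarrow> real) \<Rightarrow> (nat \<Rightarrow> nat \<Rightarrow> real) \<Rightarrow> nat \<Rightarrow> nat \<Rightarrow> nat \<Rightarrow> real" where
  "c_coef E F k i j =
     (\<Sum>m=1..k-1. E i m * E j (k - m)) + (\<Sum>m=1..k-1. F i m * F j (k - m))"

definition d_coef :: "(nat \<Rightarrow> nat \<Rightarrow> real) \<Rightarrow> (nat \<Rightarrow> nat \<Rightarrow> real) \<Rightarrow> nat \<Rightarrow> nat \<Rightarrow> nat \<Rightarrow> real" where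
  "d_coef E F k i j =
     (\<Sum>m=1..k-1. F i m * E j (k - m)) - (\<Sum>m=1..k-1. E i m * F j (k - m))"

definition epsilon_P ::
    "network \<Rightarrow> (nat \<Rightarrow> nat \<Rightarrow> real) \<Rightarrow> (nat \<Rightarrow> nat \<Rightarrow> real) \<Rightarrow> nat \<Rightarrow> nat \<Rightarrow> real" where
  "epsilon_P nw E F k i =
     (\<Sum>j=1..nbus nw. gY nw i j * c_coef E F k i j)
     + (\<Sum>j=1..nbus nw. bY nw i j * d_coef E F k i j) - psp nw i * rho k"

definition mu_Q ::
    "network \<Rightarrow> (nat \<Rightarrow> nat \<Rightarrow> real) \<Rightarrow> (nat \<Rightarrow> nat \<Rightarrow> real) \<Rightarrow> nat \<Rightarrow> nat \<Rightarrow> real" where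
  "mu_Q nw E F k i =
     - (\<Sum>j=1..nbus nw. bY nw i j * c_coef E F k i j)
     + (\<Sum>j=1..nbus nw. gY nw i j * d_coef E F k i j) - qsp nw i * rho k"

definition sigma_V ::
    "network \<Rightarrow> (nat \<Rightarrow> nat \<Rightarrow> real) \<Rightarrow> (nat \<Rightarrow> nat \<Rightarrow> real) \<Rightarrow> nat \<Rightarrow> nat \<Rightarrow> real" where
  "sigma_V nw E F k i = c_coef E F k i i - (vsp nw i)\<^sup>2 * rho k"

definition A_gy ::
    "network \<Rightarrow> (nat \<Rightarrow> nat \<Rightarrow> real) \<Rightarrow> (nat \<Rightarrow> nat \<Rightarrow> real) \<Rightarrow> real mat" where
  "A_gy nw E F =
     mat_of_rows (2 * nbus nw) (interleave (pq_buses nw) (a_P nw E F) (a_Q nw E F))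
     @\<^sub>r mat_of_rows (2 * nbus nw) (interleave (pv_buses nw) (a_P nw E F) (a_V nw E F))
     @\<^sub>r mat_of_rows (2 * nbus nw) (interleave (ref_buses nw) (a_E nw) (a_F nw))"

text \<open>The one-column matrices $A_{g\lambda}$ and $B_g$ are represented as vectors.\<close>

definition A_glambda :: "network \<Rightarrow> real vec" where
  "A_glambda nw =
     (- vec_of_list (interleave (pq_buses nw) (dp nw) (dq nw)))
     @\<^sub>v (- vec_of_list (interleave (pv_buses nw) (dp nw) (\<lambda>i. 0)))
     @\<^sub>v vec_of_list (interleave (ref_buses nw) (\<lambda>i. 0) (\<lambda>i. 0))"

definition B_g ::
    "network \<Rightarrow> (nat \<Rightarrow> nat \<Rightarrow> real) \<Rightarrow> (nat \<Rightarrow> nat \<Rightarrow> real) \<Rightarrow> nat \<Rightarrow> real vec" where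
  "B_g nw E F k =
     vec_of_list (interleave (pq_buses nw) (epsilon_P nw E F k) (mu_Q nw E F k))
     @\<^sub>v vec_of_list (interleave (pv_buses nw) (epsilon_P nw E F k) (sigma_V nw E F k))
     @\<^sub>v vec_of_list (interleave (ref_buses nw) (\<lambda>i. - esp nw i * rho k) (\<lambda>i. - fsp nw i * rho k))"

end

theory Submission
  imports Defs
begin

text \<open>
  The Leibniz rule turns products into convolutions, so the order-\<open>k\<close> coefficient of each
  component of $g(y,\lambda)$ is the residual of the corresponding transformed equation. For
  \<open>k \<ge> 1\<close> the order-\<open>k\<close> unknowns occur in \<open>(X \<star> Y) k\<close> only in the two boundary terms
  \<open>X 0 * Y k + X k * Y 0\<close>, hence linearly with coefficients of order 0; the inner part of the
  convolution involves orders 1 to \<open>k - 1\<close> only and goes into \<open>B_g\<close>.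
\<close>

unbundle no inner_syntax

section \<open>Differential transforms of polynomial expressions\<close>

text \<open>Smoothness is bundled with the transform because \<open>deriv\<close> is total:
  \<open>dt x = X\<close> alone says nothing about differentiability, so it would not propagate
  through sums and products.\<close>

definition has_dt :: "(real \<Rightarrow> real) \<Rightarrow> (nat \<Rightarrow> real) \<Rightarrow> bool" where
  "has_dt x X \<longleftrightarrow> smooth_near_0 x \<and> dt x = X"

text \<open>A tower of functions near 0 that starts with \<open>x\<close>, each the derivative of
  the one before, must consist of the iterated derivatives of \<open>x\<close>. The constant, sum
  and product rules thus only have to supply such a tower.\<close>

lemma has_dt_higher_derivs:
  assumes "r > 0"
    and init: "\<And>t. \<bar>t\<bar> < r \<Longrightarrow> D 0 t = x t"
    and step: "\<And>n t. \<bar>t\<bar> < r \<Longrightarrow> (D n has_real_derivative D (Suc n) t) (at t)"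
  shows "has_dt x (\<lambda>k. D k 0 / fact k)"
proof -
  \<comment> \<open>The iterated derivative agrees with \<open>D n\<close> only inside the interval;
    since the interval is open, that suffices to carry the derivative over.\<close>
  have transform: "(h has_real_derivative D (Suc n) t) (at t)"
    if "\<And>s. \<bar>s\<bar> < r \<Longrightarrow> h s = D n s" and "\<bar>t\<bar> < r" for h n t
    by (rule has_field_derivative_transform_within_open[OF step[OF that(2)], of "ball 0 r"])
       (use that in auto)
  have *: "(deriv ^^ n) x t = D n t" if "\<bar>t\<bar> < r" for n t
    using that
  proof (induction n arbitrary: t)
    case (Suc n)
    then show ?case using transform[of "(deriv ^^ n) x" n t] by (simp add: DERIV_imp_deriv)
  qed (simp add: init)
  have "(deriv ^^ n) x differentiable (at t)" if "\<bar>t\<bar> < r" for n t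
    using transform[of "(deriv ^^ n) x" n t] * that real_differentiable_def by blast
  then have "smooth_near_0 x"
    using \<open>r > 0\<close> unfolding smooth_near_0_def by blast
  then show ?thesis
    using * \<open>r > 0\<close> by (simp add: has_dt_def dt_def fun_eq_iff)
qed

lemma smooth_near_0_common_radius:
  assumes "smooth_near_0 x" "smooth_near_0 y"
  obtains r where "r > 0"
    and "\<And>n t. \<bar>t\<bar> < r \<Longrightarrow> ((deriv ^^ n) x has_real_derivative (deriv ^^ Suc n) x t) (at t)"
    and "\<And>n t. \<bar>t\<bar> < r \<Longrightarrow> ((deriv ^^ n) y has_real_derivative (deriv ^^ Suc n) y t) (at t)"
proof -
  have der: "\<exists>r>0. \<forall>n t. \<bar>t\<bar> < r \<longrightarrow>
      ((deriv ^^ n) z has_real_derivative (deriv ^^ Suc n) z t) (at t)" if "smooth_near_0 z" for z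
    using that unfolding smooth_near_0_def
    by (auto simp: real_differentiable_def DERIV_deriv_iff_real_differentiable)
  obtain r s where "r > 0" "s > 0"
    "\<And>n t. \<bar>t\<bar> < r \<Longrightarrow> ((deriv ^^ n) x has_real_derivative (deriv ^^ Suc n) x t) (at t)"
    "\<And>n t. \<bar>t\<bar> < s \<Longrightarrow> ((deriv ^^ n) y has_real_derivative (deriv ^^ Suc n) y t) (at t)"
    using der[OF assms(1)] der[OF assms(2)] by blast
  then show ?thesis by (intro that[of "min r s"]) auto
qed

text \<open>The tower of zero functions serves here. This handles trajectories that solve the power
  flow system only near \<open>t = 0\<close>.\<close>

lemma dt_eventually_0:
  assumes "\<forall>\<^sub>F t in nhds 0. x t = 0"
  shows "dt x k = 0"
proof -
  obtain r where "r > 0" "\<And>t. \<bar>t\<bar> < r \<Longrightarrow> x t = 0"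
    using assms by (auto simp: eventually_nhds_metric dist_real_def)
  then have "has_dt x (\<lambda>k. 0 / fact k)"
    using has_dt_higher_derivs[of r "\<lambda>_ _. 0" x] by simp
  then show ?thesis by (simp add: has_dt_def)
qed

lemma has_dt_const: "has_dt (\<lambda>t. c) (\<lambda>k. c * rho k)"
proof -
  have "has_dt (\<lambda>t. c) (\<lambda>k. (if k = 0 then c else 0) / fact k)"
    by (rule has_dt_higher_derivs[of 1]) simp_all
  also have "(\<lambda>k. (if k = 0 then c else 0) / fact k) = (\<lambda>k. c * rho k)"
    by (simp add: fun_eq_iff rho_def)
  finally show ?thesis .
qed

lemma has_dt_add:
  assumes "has_dt x X" "has_dt y Y"
  shows "has_dt (\<lambda>t. x t + y t) (\<lambda>k. X k + Y k)"
proof -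
  obtain r where r: "r > 0"
    "\<And>n t. \<bar>t\<bar> < r \<Longrightarrow> ((deriv ^^ n) x has_real_derivative (deriv ^^ Suc n) x t) (at t)"
    "\<And>n t. \<bar>t\<bar> < r \<Longrightarrow> ((deriv ^^ n) y has_real_derivative (deriv ^^ Suc n) y t) (at t)"
    using smooth_near_0_common_radius assms unfolding has_dt_def by blast
  have "has_dt (\<lambda>t. x t + y t) (\<lambda>k. ((deriv ^^ k) x 0 + (deriv ^^ k) y 0) / fact k)"
    by (rule has_dt_higher_derivs[OF r(1)]) (simp, intro DERIV_add r(2,3))
  then show ?thesis
    using assms by (auto simp: has_dt_def dt_def add_divide_distrib)
qed

text \<open>The passage from order \<open>n\<close> to \<open>Suc n\<close> in the general Leibniz
  rule, with \<open>a i\<close> and \<open>b i\<close> in place of the \<open>i\<close>-th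
  derivatives of the two factors; it is Pascal's rule after shifting the index.\<close>

lemma leibniz_step:
  fixes a b :: "nat \<Rightarrow> 'a::comm_semiring_1"
  shows "(\<Sum>i\<le>n. of_nat (n choose i) * (a (Suc i) * b (n - i) + a i * b (Suc (n - i))))
    = (\<Sum>i\<le>Suc n. of_nat (Suc n choose i) * (a i * b (Suc n - i)))"
proof -
  \<comment> \<open>Extending the range to \<open>Suc n\<close> costs nothing because
    \<open>n choose Suc n = 0\<close>, and it makes the index shift available.\<close>
  have "(\<Sum>i\<le>n. of_nat (n choose i) * (a i * b (Suc (n - i))))
      = (\<Sum>i\<le>Suc n. of_nat (n choose i) * (a i * b (Suc n - i)))"
    by (simp add: Suc_diff_le binomial_eq_0)
  also have "\<dots> = a 0 * b (Suc n) + (\<Sum>i\<le>n. of_nat (n choose Suc i) * (a (Suc i) * b (n - i)))"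
    by (subst sum.atMost_Suc_shift) simp
  finally show ?thesis
    by (subst sum.atMost_Suc_shift) (simp add: algebra_simps sum.distrib)
qed

text \<open>The Leibniz sums form the tower. Dividing by \<open>fact k\<close> turns
  \<open>k choose i\<close> into \<open>1 / (fact i * fact (k - i))\<close>, hence the sums into
  convolutions of Taylor coefficients.\<close>

lemma has_dt_mult:
  assumes "has_dt x X" "has_dt y Y"
  shows "has_dt (\<lambda>t. x t * y t) (X \<star> Y)"
proof -
  obtain r where r: "r > 0"
    "\<And>n t. \<bar>t\<bar> < r \<Longrightarrow> ((deriv ^^ n) x has_real_derivative (deriv ^^ Suc n) x t) (at t)"
    "\<And>n t. \<bar>t\<bar> < r \<Longrightarrow> ((deriv ^^ n) y has_real_derivative (deriv ^^ Suc n) y t) (at t)"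
    using smooth_near_0_common_radius assms unfolding has_dt_def by blast
  let ?D = "\<lambda>n t. \<Sum>i\<le>n. real (n choose i) * ((deriv ^^ i) x t * (deriv ^^ (n - i)) y t)"
  have der: "(?D n has_real_derivative ?D (Suc n) t) (at t)" if "\<bar>t\<bar> < r" for n t
    unfolding leibniz_step[of n "\<lambda>i. (deriv ^^ i) x t" "\<lambda>i. (deriv ^^ i) y t", symmetric]
    by (intro DERIV_sum DERIV_cmult DERIV_cong[OF DERIV_mult'[OF r(2,3)[OF that]]]) simp
  have "has_dt (\<lambda>t. x t * y t) (\<lambda>k. ?D k 0 / fact k)"
    by (rule has_dt_higher_derivs[OF r(1)]) (simp, rule der)
  moreover have "?D k 0 / fact k = (dt x \<star> dt y) k" for k
    by (simp add: dt_def dt_conv_def sum_divide_distrib atLeast0AtMost binomial_fact field_simps)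
  ultimately show ?thesis
    using assms unfolding has_dt_def by (metis (no_types, lifting) ext)
qed

text \<open>A special case of the product rule: \<open>rho\<close> is the unit of the
  convolution.\<close>

lemma has_dt_cmult:
  assumes "has_dt x X"
  shows "has_dt (\<lambda>t. c * x t) (\<lambda>k. c * X k)"
proof -
  have "((\<lambda>k. c * rho k) \<star> X) k = c * X k" for k
  proof -
    have "((\<lambda>k. c * rho k) \<star> X) k = (\<Sum>m=0..k. if m = 0 then c * X k else 0)"
      unfolding dt_conv_def by (intro sum.cong) (auto simp: rho_def)
    then show ?thesis by simp
  qed
  then show ?thesis using has_dt_mult[OF has_dt_const assms, of c] by presburger
qed

lemma has_dt_diff:
  assumes "has_dt x X" "has_dt y Y"
  shows "has_dt (\<lambda>t. x t - y t) (\<lambda>k. X k - Y k)"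
  using has_dt_add[OF assms(1) has_dt_cmult[OF assms(2), of "-1"]] by simp

lemma has_dt_sum:
  "(\<And>j. j \<in> A \<Longrightarrow> has_dt (x j) (X j)) \<Longrightarrow> has_dt (\<lambda>t. \<Sum>j\<in>A. x j t) (\<lambda>k. \<Sum>j\<in>A. X j k)"
proof (induction A rule: infinite_finite_induct)
  case (insert j A)
  then show ?case by (simp add: has_dt_add)
\<comment> \<open>Sums over empty or infinite sets are 0, so both remaining cases are the constant
  0.\<close>
qed (use has_dt_const[of 0] in simp_all)

lemmas has_dt_intros = has_dt_const has_dt_add has_dt_diff has_dt_mult has_dt_cmult has_dt_sum

definition inner_conv :: "(nat \<Rightarrow> real) \<Rightarrow> (nat \<Rightarrow> real) \<Rightarrow> nat \<Rightarrow> real" where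
  "inner_conv X Y k = (\<Sum>m=1..k-1. X m * Y (k - m))"

lemma dt_conv_split:
  assumes "1 \<le> k"
  shows "(X \<star> Y) k = X 0 * Y k + X k * Y 0 + inner_conv X Y k"
proof -
  \<comment> \<open>Since \<open>k\<close> is not 0, the indices 0 and \<open>k\<close> are distinct
    and contribute two separate terms.\<close>
  have "{0..k} = insert 0 (insert k {1..k-1})" "k \<noteq> 0"
    using assms by auto
  then show ?thesis by (simp add: dt_conv_def inner_conv_def)
qed

section \<open>Interleaved vectors\<close>

lemma length_interleave: "length (interleave is u v) = 2 * length is"
  by (induction "is") (simp_all add: interleave_def)

lemma set_interleave: "set (interleave is u v) = u ` set is \<union> v ` set is"
  by (induction "is") (auto simp: interleave_def)

lemma map_interleave: "map h (interleave is u v) = interleave is (\<lambda>i. h (u i)) (\<lambda>i. h (v i))"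
  by (induction "is") (simp_all add: interleave_def)

lemma interleave_cong:
  "(\<And>i. i \<in> set is \<Longrightarrow> u i = u' i \<and> v i = v' i) \<Longrightarrow> interleave is u v = interleave is u' v'"
  by (auto simp: interleave_def intro!: arg_cong[of _ _ concat])

lemma vec_of_list_append: "vec_of_list (xs @ ys) = vec_of_list xs @\<^sub>v vec_of_list ys"
  by (intro eq_vecI) (auto simp: vec_of_list_index nth_append)

lemma interleave_add:
  "vec_of_list (interleave is u v) + vec_of_list (interleave is u' v')
     = vec_of_list (interleave is (\<lambda>i. u i + u' i) (\<lambda>i. v i + v' i))"
  for u v :: "nat \<Rightarrow> 'a::plus"
proof -
  have "interleave is (\<lambda>i. u i + u' i) (\<lambda>i. v i + v' i)
      = map2 (+) (interleave is u v) (interleave is u' v')"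
    by (induction "is") (simp_all add: interleave_def)
  then show ?thesis
    by (intro eq_vecI) (simp_all add: vec_of_list_index length_interleave)
qed

lemma interleave_smult:
  "c \<cdot>\<^sub>v vec_of_list (interleave is u v)
     = vec_of_list (interleave is (\<lambda>i. c * u i) (\<lambda>i. c * v i))"
  by (simp only: map_interleave[of "(*) c", symmetric])
     (auto simp: vec_of_list_index length_interleave simp del: vec_of_list_map)

lemma interleave_uminus:
  "- vec_of_list (interleave is u v) = vec_of_list (interleave is (\<lambda>i. - u i) (\<lambda>i. - v i))"
  by (simp only: map_interleave[of uminus, symmetric])
     (auto simp: vec_of_list_index length_interleave simp del: vec_of_list_map)

lemma interleave_scalar_prod:
  "vec_of_list (interleave is u v) \<bullet> vec_of_list (interleave is u' v')
     = (\<Sum>i\<leftarrow>is. u i * u' i + v i * v' i)"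
  for u v :: "nat \<Rightarrow> 'a::comm_semiring_0"
proof (induction "is")
  case (Cons i "is")
  then show ?case by (simp add: interleave_def scalar_prod_vCons add.assoc)
qed (simp add: interleave_def scalar_prod_def)

lemma smult_append_vec: "c \<cdot>\<^sub>v (v @\<^sub>v w) = (c \<cdot>\<^sub>v v) @\<^sub>v (c \<cdot>\<^sub>v w)"
  by (intro eq_vecI) auto

text \<open>\<open>mat_of_rows n\<close> reads exactly \<open>n\<close> entries of each vector, so
  the dimension hypothesis is what makes row \<open>r\<close> equal to
  \<open>vs ! r\<close>.\<close>

lemma mat_of_rows_mult_vec:
  assumes "\<And>v. v \<in> set vs \<Longrightarrow> dim_vec v = n"
  shows "mat_of_rows n vs *\<^sub>v y = vec_of_list (map (\<lambda>v. v \<bullet> y) vs)"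
proof (rule eq_vecI)
  fix r assume "r < dim_vec (vec_of_list (map (\<lambda>v. v \<bullet> y) vs))"
  then have r: "r < length vs" by simp
  have "vs ! r \<in> carrier_vec n"
    using assms[OF nth_mem[OF r]] by (rule carrier_vecI)
  with r show "(mat_of_rows n vs *\<^sub>v y) $ r = vec_of_list (map (\<lambda>v. v \<bullet> y) vs) $ r"
    by (simp add: vec_of_list_index mat_of_rows_row del: vec_of_list_map)
qed simp

lemma mat_of_rows_interleave_mult:
  assumes "\<And>i. i \<in> set is \<Longrightarrow> dim_vec (a i) = n \<and> dim_vec (b i) = n"
  shows "mat_of_rows n (interleave is a b) *\<^sub>v y
    = vec_of_list (interleave is (\<lambda>i. a i \<bullet> y) (\<lambda>i. b i \<bullet> y))"
  unfolding map_interleave[of "\<lambda>v. v \<bullet> y" "is" a b, symmetric]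
  by (rule mat_of_rows_mult_vec) (use assms in \<open>auto simp: set_interleave\<close>)


section \<open>The power flow equations of a given order\<close>

text \<open>The common middle term of the proof: it is compared with the transform of
  \<open>power_flow_map\<close>, with the linear form, and with the residuals of the transformed
  equations.\<close>

definition power_flow_dt ::
    "network \<Rightarrow> (nat \<Rightarrow> real \<Rightarrow> real) \<Rightarrow> (nat \<Rightarrow> real \<Rightarrow> real) \<Rightarrow> (real \<Rightarrow> real) \<Rightarrow> nat \<Rightarrow> real list" where
  "power_flow_dt nw e f l k =
     interleave (pq_buses nw)
       (\<lambda>i. dt (\<lambda>t. g_P nw (\<lambda>i. e i t) (\<lambda>i. f i t) (l t) i) k)
       (\<lambda>i. dt (\<lambda>t. g_Q nw (\<lambda>i. e i t) (\<lambda>i. f i t) (l t) i) k)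
     @ interleave (pv_buses nw)
       (\<lambda>i. dt (\<lambda>t. g_P nw (\<lambda>i. e i t) (\<lambda>i. f i t) (l t) i) k)
       (\<lambda>i. dt (\<lambda>t. g_V nw (\<lambda>i. e i t) (\<lambda>i. f i t) i) k)
     @ interleave (ref_buses nw)
       (\<lambda>i. dt (\<lambda>t. e i t - esp nw i) k) (\<lambda>i. dt (\<lambda>t. f i t - fsp nw i) k)"

lemma set_buses:
  assumes "nPQ nw < nbus nw"
  shows "set (pq_buses nw) \<subseteq> {1..nbus nw}" "set (pv_buses nw) \<subseteq> {1..nbus nw}"
    "set (ref_buses nw) \<subseteq> {1..nbus nw}"
  using assms by (auto simp: pq_buses_def pv_buses_def ref_buses_def)

text \<open>The bus lists have \<open>nPQ nw\<close>, \<open>nbus nw - nPQ nw - 1\<close> and 1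
  entries; the hypothesis keeps the subtraction of naturals exact.\<close>

lemma length_power_flow_dt: "nPQ nw < nbus nw \<Longrightarrow> length (power_flow_dt nw e f l k) = 2 * nbus nw"
  by (simp add: power_flow_dt_def length_interleave pq_buses_def pv_buses_def ref_buses_def del: upt_Suc)

lemma dt_power_flow_map:
  assumes "nPQ nw < nbus nw"
  shows "vec (2 * nbus nw)
      (\<lambda>r. dt (\<lambda>t. power_flow_map nw (\<lambda>i. e i t) (\<lambda>i. f i t) (l t) $ r) k)
    = vec_of_list (power_flow_dt nw e f l k)"
proof -
  \<comment> \<open>With the components kept as functions of time, \<open>power_flow_map\<close> and
    \<open>power_flow_dt\<close> are both maps over this one list: evaluation at \<open>t\<close>
    and the transform at order \<open>k\<close>.\<close>
  define hs where "hs =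
    interleave (pq_buses nw)
      (\<lambda>i t. g_P nw (\<lambda>i. e i t) (\<lambda>i. f i t) (l t) i)
      (\<lambda>i t. g_Q nw (\<lambda>i. e i t) (\<lambda>i. f i t) (l t) i)
    @ interleave (pv_buses nw)
      (\<lambda>i t. g_P nw (\<lambda>i. e i t) (\<lambda>i. f i t) (l t) i)
      (\<lambda>i t. g_V nw (\<lambda>i. e i t) (\<lambda>i. f i t) i)
    @ interleave (ref_buses nw)
      (\<lambda>i t. e i t - esp nw i) (\<lambda>i t. f i t - fsp nw i)"
  have pf: "power_flow_map nw (\<lambda>i. e i t) (\<lambda>i. f i t) (l t) = vec_of_list (map (\<lambda>h. h t) hs)" for t
    by (simp only: power_flow_map_def hs_def map_append map_interleave)
  have dt: "power_flow_dt nw e f l k = map (\<lambda>h. dt h k) hs"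
    by (simp only: power_flow_dt_def hs_def map_append map_interleave)
  then have len: "length hs = 2 * nbus nw"
    using length_power_flow_dt[OF assms, of e f l k] by simp
  show ?thesis
    unfolding pf dt
    by (rule eq_vecI) (simp_all add: len vec_of_list_index del: vec_of_list_map)
qed

section \<open>Scalar products of the coefficient rows with the vector of unknowns\<close>

lemma sum_list_all_buses: "(\<Sum>i\<leftarrow>all_buses nw. h i) = (\<Sum>i=1..nbus nw. h i)"
  unfolding all_buses_def
  by (simp add: interv_sum_list_conv_sum_set_nat atLeastLessThanSuc_atLeastAtMost del: upt_Suc)

lemma Y_vec_scalar_prod:
  "vec_of_list (interleave (all_buses nw) u v) \<bullet> Y_vec nw E F k
     = (\<Sum>j=1..nbus nw. u j * E j k + v j * F j k)"
  unfolding Y_vec_def interleave_scalar_prod sum_list_all_buses ..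

text \<open>The summands \<open>p\<close>, \<open>q\<close> of the diagonal entries arise because \<open>E i k\<close> and \<open>F i k\<close> occur
  in the product with every bus \<open>j\<close> in the equation of bus \<open>i\<close>.\<close>

lemma sum_diagonal_split:
  fixes h h' x y :: "nat \<Rightarrow> 'a::comm_ring_1"
  assumes "i \<in> {1..n}"
  shows "(\<Sum>j=1..n. (if j = i then p + h j else h j) * x j + (if j = i then q + h' j else h' j) * y j)
    = p * x i + q * y i + (\<Sum>j=1..n. h j * x j + h' j * y j)"
proof -
  have "(\<Sum>j=1..n. (if j = i then p + h j else h j) * x j + (if j = i then q + h' j else h' j) * y j)
    = (\<Sum>j=1..n. (if j = i then p * x i + q * y i else 0) + (h j * x j + h' j * y j))"
    by (intro sum.cong) (auto simp: algebra_simps)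
  also have "\<dots> = p * x i + q * y i + (\<Sum>j=1..n. h j * x j + h' j * y j)"
    using assms by (simp add: sum.distrib)
  finally show ?thesis .
qed

text \<open>The first two sums collect the products in which bus \<open>i\<close> itself carries
  order \<open>k\<close>, the last sum those in which bus \<open>j\<close> does. The off-diagonal
  formula holds at \<open>j = i\<close> too once the extra sums of \<open>alpha\<close> and
  \<open>beta\<close> are split off.\<close>

lemma a_P_scalar_prod:
  assumes "i \<in> {1..nbus nw}"
  shows "a_P nw E F i \<bullet> Y_vec nw E F k =
    (\<Sum>n=1..nbus nw. gY nw i n * E n 0 - bY nw i n * F n 0) * E i k
    + (\<Sum>n=1..nbus nw. bY nw i n * E n 0 + gY nw i n * F n 0) * F i k
    + (\<Sum>j=1..nbus nw. (gY nw i j * E i 0 + bY nw i j * F i 0) * E j k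
                       + (gY nw i j * F i 0 - bY nw i j * E i 0) * F j k)"
  unfolding a_P_def Y_vec_scalar_prod
  by (rule trans[OF _ sum_diagonal_split[OF assms, where x = "\<lambda>j. E j k" and y = "\<lambda>j. F j k"]])
     (auto intro!: sum.cong simp: algebra_simps alpha_def beta_def)

text \<open>The pattern is that of the row \<open>a_P\<close>, with \<open>- bY\<close> in place of
  \<open>gY\<close> and \<open>gY\<close> in place of \<open>bY\<close>.\<close>

lemma a_Q_scalar_prod:
  assumes "i \<in> {1..nbus nw}"
  shows "a_Q nw E F i \<bullet> Y_vec nw E F k =
    - (\<Sum>n=1..nbus nw. bY nw i n * E n 0 + gY nw i n * F n 0) * E i k
    + (\<Sum>n=1..nbus nw. gY nw i n * E n 0 - bY nw i n * F n 0) * F i k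
    + (\<Sum>j=1..nbus nw. (- bY nw i j * E i 0 + gY nw i j * F i 0) * E j k
                       + (- bY nw i j * F i 0 - gY nw i j * E i 0) * F j k)"
  unfolding a_Q_def Y_vec_scalar_prod
  by (rule trans[OF _ sum_diagonal_split[OF assms, where x = "\<lambda>j. E j k" and y = "\<lambda>j. F j k"]])
     (auto intro!: sum.cong simp: algebra_simps phi_def psi_def)

lemma single_bus_scalar_prod:
  assumes "i \<in> {1..nbus nw}"
  shows "a_V nw E F i \<bullet> Y_vec nw E F k = 2 * E i 0 * E i k + 2 * F i 0 * F i k"
    and "a_E nw i \<bullet> Y_vec nw E F k = E i k"
    and "a_F nw i \<bullet> Y_vec nw E F k = F i k"
  unfolding a_V_def a_E_def a_F_def Y_vec_scalar_prod
  using assms by (simp_all add: sum.distrib if_distrib[of "\<lambda>x. x * _"] cong: if_cong)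

text \<open>Pure linear algebra in an arbitrary vector \<open>y\<close>: each block of rows
  contributes one interleaved list, so the linear form can be compared entry by entry with
  \<open>power_flow_dt\<close>.\<close>

lemma linear_form_as_list:
  assumes "dim_vec y = 2 * nbus nw"
  shows "A_gy nw E F *\<^sub>v y + c \<cdot>\<^sub>v A_glambda nw + B_g nw E F k = vec_of_list
     (interleave (pq_buses nw)
        (\<lambda>i. a_P nw E F i \<bullet> y + c * - dp nw i + epsilon_P nw E F k i)
        (\<lambda>i. a_Q nw E F i \<bullet> y + c * - dq nw i + mu_Q nw E F k i)
      @ interleave (pv_buses nw)
        (\<lambda>i. a_P nw E F i \<bullet> y + c * - dp nw i + epsilon_P nw E F k i)
        (\<lambda>i. a_V nw E F i \<bullet> y + sigma_V nw E F k i)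
      @ interleave (ref_buses nw)
        (\<lambda>i. a_E nw i \<bullet> y + - esp nw i * rho k)
        (\<lambda>i. a_F nw i \<bullet> y + - fsp nw i * rho k))"
proof -
  have dims: "dim_vec (a_P nw E F i) = 2 * nbus nw" "dim_vec (a_Q nw E F i) = 2 * nbus nw"
    "dim_vec (a_V nw E F i) = 2 * nbus nw" "dim_vec (a_E nw i) = 2 * nbus nw"
    "dim_vec (a_F nw i) = 2 * nbus nw" for i
    by (simp_all add: a_P_def a_Q_def a_V_def a_E_def a_F_def length_interleave all_buses_def)
  have y: "y \<in> carrier_vec (2 * nbus nw)"
    using assms by (rule carrier_vecI)
  have add: "(u @\<^sub>v v) + (u' @\<^sub>v v') = (u + u') @\<^sub>v (v + v')"
    if "dim_vec u = dim_vec u'" "dim_vec v = dim_vec v'" for u u' v v' :: "real vec"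
    using that by (intro eq_vecI) auto
  have A_gy: "A_gy nw E F *\<^sub>v y =
      vec_of_list (interleave (pq_buses nw) (\<lambda>i. a_P nw E F i \<bullet> y) (\<lambda>i. a_Q nw E F i \<bullet> y))
      @\<^sub>v vec_of_list (interleave (pv_buses nw) (\<lambda>i. a_P nw E F i \<bullet> y) (\<lambda>i. a_V nw E F i \<bullet> y))
      @\<^sub>v vec_of_list (interleave (ref_buses nw) (\<lambda>i. a_E nw i \<bullet> y) (\<lambda>i. a_F nw i \<bullet> y))"
    unfolding A_gy_def
      mat_mult_append[OF mat_of_rows_carrier(1)
        carrier_append_rows[OF mat_of_rows_carrier(1) mat_of_rows_carrier(1)] y]
      mat_mult_append[OF mat_of_rows_carrier(1) mat_of_rows_carrier(1) y]
    by (intro arg_cong2[of _ _ _ _ append_vec] mat_of_rows_interleave_mult conjI dims)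
  \<comment> \<open>The zero entries stay as \<open>c * - 0\<close> and \<open>c * 0\<close>, the
    literal result of negating and scaling; the final simplification removes them.\<close>
  have A_glambda: "c \<cdot>\<^sub>v A_glambda nw =
      vec_of_list (interleave (pq_buses nw) (\<lambda>i. c * - dp nw i) (\<lambda>i. c * - dq nw i))
      @\<^sub>v vec_of_list (interleave (pv_buses nw) (\<lambda>i. c * - dp nw i) (\<lambda>i. c * - 0))
      @\<^sub>v vec_of_list (interleave (ref_buses nw) (\<lambda>i. c * 0) (\<lambda>i. c * 0))"
    unfolding A_glambda_def smult_append_vec interleave_uminus interleave_smult ..
  show ?thesis
    unfolding A_gy A_glambda B_g_def vec_of_list_append
    by (simp only: add interleave_add index_append_vec index_add_vec dim_vec_of_list length_interleave)
       simp
qed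

section \<open>Rows of the linear form as residuals of the transformed equations\<close>

lemma c_coef_eq: "c_coef E F k i j = inner_conv (E i) (E j) k + inner_conv (F i) (F j) k"
  and d_coef_eq: "d_coef E F k i j = inner_conv (F i) (E j) k - inner_conv (E i) (F j) k"
  by (simp_all add: c_coef_def d_coef_def inner_conv_def)

text \<open>An algebraic identity for arbitrary sequences: after splitting every convolution, the
  boundary terms are those of \<open>a_P_scalar_prod\<close> and the inner terms those of
  \<open>epsilon_P\<close>. Here \<open>c\<close> stands for \<open>L k\<close>.\<close>

lemma linear_residual_P:
  assumes "i \<in> {1..nbus nw}" "1 \<le> k"
  shows "a_P nw E F i \<bullet> Y_vec nw E F k + c * - dp nw i + epsilon_P nw E F k i =
    - dp nw i * c
    + (\<Sum>j=1..nbus nw. gY nw i j * ((E i \<star> E j) k + (F i \<star> F j) k))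
    + (\<Sum>j=1..nbus nw. bY nw i j * ((F i \<star> E j) k - (E i \<star> F j) k))
    - psp nw i * rho k"
  unfolding a_P_scalar_prod[OF assms(1)] epsilon_P_def c_coef_eq d_coef_eq
    dt_conv_split[OF assms(2)] sum_distrib_right
  by (simp add: algebra_simps flip: sum.distrib sum_subtractf)

lemma linear_residual_Q:
  assumes "i \<in> {1..nbus nw}" "1 \<le> k"
  shows "a_Q nw E F i \<bullet> Y_vec nw E F k + c * - dq nw i + mu_Q nw E F k i =
    - dq nw i * c
    - (\<Sum>j=1..nbus nw. bY nw i j * ((E i \<star> E j) k + (F i \<star> F j) k))
    + (\<Sum>j=1..nbus nw. gY nw i j * ((F i \<star> E j) k - (E i \<star> F j) k))
    - qsp nw i * rho k"
  unfolding a_Q_scalar_prod[OF assms(1)] mu_Q_def c_coef_eq d_coef_eq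
    dt_conv_split[OF assms(2)] sum_distrib_right sum_negf[symmetric]
  by (simp add: algebra_simps flip: sum.distrib sum_subtractf sum_negf)

text \<open>In a square the two boundary terms of the convolution coincide, which accounts for the
  factor 2 in \<open>a_V\<close>.\<close>

lemma linear_residual_V:
  assumes "i \<in> {1..nbus nw}" "1 \<le> k"
  shows "a_V nw E F i \<bullet> Y_vec nw E F k + sigma_V nw E F k i =
    (E i \<star> E i) k + (F i \<star> F i) k - (vsp nw i)\<^sup>2 * rho k"
  by (simp add: single_bus_scalar_prod[OF assms(1)] sigma_V_def c_coef_eq dt_conv_split[OF assms(2)])

section \<open>Transforms of the power flow components along smooth trajectories\<close>

locale smooth_network =
  fixes nw :: network and e f :: "nat \<Rightarrow> real \<Rightarrow> real" and l :: "real \<Rightarrow> real"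
  assumes PQ_lt_bus: "nPQ nw < nbus nw"
    and smooth_e: "\<And>i. i \<in> {1..nbus nw} \<Longrightarrow> smooth_near_0 (e i)"
    and smooth_f: "\<And>i. i \<in> {1..nbus nw} \<Longrightarrow> smooth_near_0 (f i)"
    and smooth_l: "smooth_near_0 l"
begin

abbreviation "E \<equiv> \<lambda>i. dt (e i)"
abbreviation "F \<equiv> \<lambda>i. dt (f i)"
abbreviation "L \<equiv> dt l"

lemma has_dt_e: "i \<in> {1..nbus nw} \<Longrightarrow> has_dt (e i) (E i)"
  and has_dt_f: "i \<in> {1..nbus nw} \<Longrightarrow> has_dt (f i) (F i)"
  and has_dt_l: "has_dt l L"
  using smooth_e smooth_f smooth_l by (simp_all add: has_dt_def)

lemma dt_P:
  assumes i: "i \<in> {1..nbus nw}"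
  shows "dt (\<lambda>t. g_P nw (\<lambda>i. e i t) (\<lambda>i. f i t) (l t) i) k =
    - dp nw i * L k
    + (\<Sum>j=1..nbus nw. gY nw i j * ((E i \<star> E j) k + (F i \<star> F j) k))
    + (\<Sum>j=1..nbus nw. bY nw i j * ((F i \<star> E j) k - (E i \<star> F j) k))
    - psp nw i * rho k"
proof -
  \<comment> \<open>The load term is written with its constant factor first, as the rule for
    constant multiples expects; the last step reconciles this with the order of factors in
    \<open>g_P\<close>.\<close>
  have "has_dt (\<lambda>t. - dp nw i * l t
       + (\<Sum>j=1..nbus nw. gY nw i j * (e i t * e j t + f i t * f j t))
       + (\<Sum>j=1..nbus nw. bY nw i j * (f i t * e j t - e i t * f j t)) - psp nw i)
    (\<lambda>k. - dp nw i * L k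
       + (\<Sum>j=1..nbus nw. gY nw i j * ((E i \<star> E j) k + (F i \<star> F j) k))
       + (\<Sum>j=1..nbus nw. bY nw i j * ((F i \<star> E j) k - (E i \<star> F j) k)) - psp nw i * rho k)"
    by (intro has_dt_intros has_dt_e has_dt_f has_dt_l i)
  then show ?thesis
    by (simp only: has_dt_def g_P_def mult.commute[of "- l _"] mult_minus_left mult_minus_right
        mult.commute[of "l _"])
qed

lemma dt_Q:
  assumes i: "i \<in> {1..nbus nw}"
  shows "dt (\<lambda>t. g_Q nw (\<lambda>i. e i t) (\<lambda>i. f i t) (l t) i) k =
    - dq nw i * L k
    - (\<Sum>j=1..nbus nw. bY nw i j * ((E i \<star> E j) k + (F i \<star> F j) k))
    + (\<Sum>j=1..nbus nw. gY nw i j * ((F i \<star> E j) k - (E i \<star> F j) k))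
    - qsp nw i * rho k"
proof -
  have "has_dt (\<lambda>t. - dq nw i * l t
       - (\<Sum>j=1..nbus nw. bY nw i j * (e i t * e j t + f i t * f j t))
       + (\<Sum>j=1..nbus nw. gY nw i j * (f i t * e j t - e i t * f j t)) - qsp nw i)
    (\<lambda>k. - dq nw i * L k
       - (\<Sum>j=1..nbus nw. bY nw i j * ((E i \<star> E j) k + (F i \<star> F j) k))
       + (\<Sum>j=1..nbus nw. gY nw i j * ((F i \<star> E j) k - (E i \<star> F j) k)) - qsp nw i * rho k)"
    by (intro has_dt_intros has_dt_e has_dt_f has_dt_l i)
  then show ?thesis
    by (simp only: has_dt_def g_Q_def mult.commute[of "- l _"] mult_minus_left mult_minus_right
        mult.commute[of "l _"])
qed

lemma dt_V:
  assumes i: "i \<in> {1..nbus nw}"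
  shows "dt (\<lambda>t. g_V nw (\<lambda>i. e i t) (\<lambda>i. f i t) i) k =
    (E i \<star> E i) k + (F i \<star> F i) k - (vsp nw i)\<^sup>2 * rho k"
proof -
  have "has_dt (\<lambda>t. e i t * e i t + f i t * f i t - (vsp nw i)\<^sup>2)
      (\<lambda>k. (E i \<star> E i) k + (F i \<star> F i) k - (vsp nw i)\<^sup>2 * rho k)"
    by (intro has_dt_intros has_dt_e has_dt_f i)
  then show ?thesis
    by (simp add: has_dt_def g_V_def power2_eq_square)
qed

lemma dt_ref:
  assumes i: "i \<in> {1..nbus nw}"
  shows "dt (\<lambda>t. e i t - esp nw i) k = E i k - esp nw i * rho k"
    and "dt (\<lambda>t. f i t - fsp nw i) k = F i k - fsp nw i * rho k"
  using has_dt_diff[OF has_dt_e[OF i] has_dt_const[of "esp nw i"]]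
    has_dt_diff[OF has_dt_f[OF i] has_dt_const[of "fsp nw i"]]
  by (simp_all add: has_dt_def)

text \<open>Entry by entry both sides are the residual of the same transformed equation: the linear
  residuals and single-bus scalar products compute the left side, \<open>dt_P\<close> to
  \<open>dt_ref\<close> the right.\<close>

lemma linear_form:
  assumes "1 \<le> k"
  shows "A_gy nw E F *\<^sub>v Y_vec nw E F k + L k \<cdot>\<^sub>v A_glambda nw + B_g nw E F k
    = vec_of_list (power_flow_dt nw e f l k)"
proof -
  have dim: "dim_vec (Y_vec nw E F k) = 2 * nbus nw"
    by (simp add: Y_vec_def length_interleave all_buses_def)
  note buses = set_buses[OF PQ_lt_bus, THEN subsetD]
  show ?thesis
    unfolding linear_form_as_list[OF dim] power_flow_dt_def
    by (intro arg_cong[of _ _ vec_of_list] arg_cong2[of _ _ _ _ "(@)"] interleave_cong;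
        drule buses; simp only: linear_residual_P[OF _ assms] linear_residual_Q[OF _ assms]
          linear_residual_V[OF _ assms] single_bus_scalar_prod(2,3) dt_P dt_Q dt_V dt_ref; simp)
qed

lemma transformed_system_iff:
  "transformed_system nw E F L k \<longleftrightarrow> (\<forall>h \<in> set (power_flow_dt nw e f l k). h = 0)"
proof -
  have *: "transformed_P nw E F L k i \<longleftrightarrow> dt (\<lambda>t. g_P nw (\<lambda>i. e i t) (\<lambda>i. f i t) (l t) i) k = 0"
    "transformed_Q nw E F L k i \<longleftrightarrow> dt (\<lambda>t. g_Q nw (\<lambda>i. e i t) (\<lambda>i. f i t) (l t) i) k = 0"
    "transformed_V nw E F k i \<longleftrightarrow> dt (\<lambda>t. g_V nw (\<lambda>i. e i t) (\<lambda>i. f i t) i) k = 0"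
    "esp nw i * rho k = E i k \<longleftrightarrow> dt (\<lambda>t. e i t - esp nw i) k = 0"
    "fsp nw i * rho k = F i k \<longleftrightarrow> dt (\<lambda>t. f i t - fsp nw i) k = 0"
    if "i \<in> {1..nbus nw}" for i
    unfolding transformed_P_def transformed_Q_def transformed_V_def
      dt_P[OF that] dt_Q[OF that] dt_V[OF that] dt_ref[OF that]
    by auto
  note buses = set_buses[OF PQ_lt_bus, THEN subsetD]
  show ?thesis
    unfolding transformed_system_def power_flow_dt_def set_append set_interleave ball_Un ball_simps(9)
    by (simp only: *[OF buses(1)] *[OF buses(2)] *[OF buses(3)] ball_conj_distrib cong: ball_cong) blast
qed

end

text \<open>This expresses dependence on orders 0 to \<open>k - 1\<close> only: \<open>A_gy\<close>
  reads order 0, which is below \<open>k\<close> because \<open>1 \<le> k\<close>, and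
  \<open>B_g\<close> reads orders 1 to \<open>k - 1\<close>. The sequences are arbitrary and need
  not be transforms of functions; \<open>A_glambda\<close> takes only network data.\<close>

lemma coefficients_cong:
  assumes "nPQ nw < nbus nw" "1 \<le> k"
    and eq: "\<forall>i \<in> {1..nbus nw}. \<forall>m<k. E' i m = E i m \<and> F' i m = F i m"
  shows "A_gy nw E' F' = A_gy nw E F" and "B_g nw E' F' k = B_g nw E F k"
proof -
  have eq0: "E' i 0 = E i 0" "F' i 0 = F i 0" if "i \<in> {1..nbus nw}" for i
    using eq that \<open>1 \<le> k\<close> by auto
  have sums: "(\<Sum>n=1..nbus nw. gY nw i n * E' n 0 - bY nw i n * F' n 0)
        = (\<Sum>n=1..nbus nw. gY nw i n * E n 0 - bY nw i n * F n 0)"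
      "(\<Sum>n=1..nbus nw. bY nw i n * E' n 0 + gY nw i n * F' n 0)
        = (\<Sum>n=1..nbus nw. bY nw i n * E n 0 + gY nw i n * F n 0)" for i
    by (intro sum.cong refl; simp add: eq0)+
  have rows: "a_P nw E' F' i = a_P nw E F i" "a_Q nw E' F' i = a_Q nw E F i"
    "a_V nw E' F' i = a_V nw E F i" if "i \<in> {1..nbus nw}" for i
    unfolding a_P_def a_Q_def a_V_def alpha_def beta_def phi_def psi_def sums eq0[OF that] by simp_all
  have conv: "c_coef E' F' k i j = c_coef E F k i j" "d_coef E' F' k i j = d_coef E F k i j"
    if "i \<in> {1..nbus nw}" "j \<in> {1..nbus nw}" for i j
    unfolding c_coef_def d_coef_def
    \<comment> \<open>For \<open>m\<close> between 1 and \<open>k - 1\<close>, both \<open>m\<close>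
      and \<open>k - m\<close> lie below \<open>k\<close>.\<close>
    by (intro arg_cong2[of _ _ _ _ "(+)"] arg_cong2[of _ _ _ _ "(-)"] sum.cong refl;
        use eq that \<open>1 \<le> k\<close> in auto)+
  have rests: "epsilon_P nw E' F' k i = epsilon_P nw E F k i" "mu_Q nw E' F' k i = mu_Q nw E F k i"
    "sigma_V nw E' F' k i = sigma_V nw E F k i" if "i \<in> {1..nbus nw}" for i
    unfolding epsilon_P_def mu_Q_def sigma_V_def using that by (simp_all add: conv)
  note buses = set_buses[OF assms(1), THEN subsetD]
  show "A_gy nw E' F' = A_gy nw E F"
    unfolding A_gy_def using rows[OF buses(1)] rows[OF buses(2)]
    by (simp add: interleave_def cong: map_cong)
  show "B_g nw E' F' k = B_g nw E F k"
    unfolding B_g_def using rests[OF buses(1)] rests[OF buses(2)]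
    by (simp add: interleave_def cong: map_cong)
qed

theorem proposition2:
  fixes nw :: network
    and e f :: "nat \<Rightarrow> real \<Rightarrow> real" and l :: "real \<Rightarrow> real"
    and E F :: "nat \<Rightarrow> nat \<Rightarrow> real" and L :: "nat \<Rightarrow> real"
    and k :: nat
  assumes "nPQ nw < nbus nw"
    and "\<forall>i \<in> {1..nbus nw}. smooth_near_0 (e i) \<and> smooth_near_0 (f i)"
    and "smooth_near_0 l"
    and "E = (\<lambda>i. dt (e i))" and "F = (\<lambda>i. dt (f i))" and "L = dt l"
    and "1 \<le> k"
  shows
    "vec (2 * nbus nw) (\<lambda>r. dt (\<lambda>t. power_flow_map nw (\<lambda>i. e i t) (\<lambda>i. f i t) (l t) $ r) k)
       = A_gy nw E F *\<^sub>v Y_vec nw E F k + L k \<cdot>\<^sub>v A_glambda nw + B_g nw E F k \<and>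
     (transformed_system nw E F L k \<longleftrightarrow>
       0\<^sub>v (2 * nbus nw)
         = A_gy nw E F *\<^sub>v Y_vec nw E F k + L k \<cdot>\<^sub>v A_glambda nw + B_g nw E F k) \<and>
     ((\<forall>\<^sub>F t in nhds 0.
         0\<^sub>v (2 * nbus nw) = power_flow_map nw (\<lambda>i. e i t) (\<lambda>i. f i t) (l t)) \<longrightarrow>
       0\<^sub>v (2 * nbus nw)
         = A_gy nw E F *\<^sub>v Y_vec nw E F k + L k \<cdot>\<^sub>v A_glambda nw + B_g nw E F k) \<and>
     (\<forall>E' F'. (\<forall>i \<in> {1..nbus nw}. \<forall>m<k. E' i m = E i m \<and> F' i m = F i m) \<longrightarrow>
       A_gy nw E' F' = A_gy nw E F \<and> B_g nw E' F' k = B_g nw E F k)"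
proof -
  interpret smooth_network nw e f l
    using assms(1-3) by unfold_locales auto
  have series: "vec (2 * nbus nw)
        (\<lambda>r. dt (\<lambda>t. power_flow_map nw (\<lambda>i. e i t) (\<lambda>i. f i t) (l t) $ r) k)
      = A_gy nw E F *\<^sub>v Y_vec nw E F k + L k \<cdot>\<^sub>v A_glambda nw + B_g nw E F k"
    unfolding assms(4-6) linear_form[OF assms(7)] by (rule dt_power_flow_map[OF assms(1)])
  have "0\<^sub>v (2 * nbus nw) = vec_of_list xs \<longleftrightarrow> (\<forall>h \<in> set xs. h = 0)"
    if "length xs = 2 * nbus nw" for xs :: "real list"
    using that by (auto simp: vec_eq_iff vec_of_list_index all_set_conv_all_nth)
  \<comment> \<open>The linear form is the vector of the residual list, so it is zero exactly when
    every residual vanishes; the length of the list makes the dimensions match.\<close>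
  then have system: "transformed_system nw E F L k \<longleftrightarrow> 0\<^sub>v (2 * nbus nw)
      = A_gy nw E F *\<^sub>v Y_vec nw E F k + L k \<cdot>\<^sub>v A_glambda nw + B_g nw E F k"
    unfolding assms(4-6) linear_form[OF assms(7)] transformed_system_iff
    by (simp add: length_power_flow_dt[OF assms(1)])
  have solution: "0\<^sub>v (2 * nbus nw)
      = A_gy nw E F *\<^sub>v Y_vec nw E F k + L k \<cdot>\<^sub>v A_glambda nw + B_g nw E F k"
    if zero: "\<forall>\<^sub>F t in nhds 0.
      0\<^sub>v (2 * nbus nw) = power_flow_map nw (\<lambda>i. e i t) (\<lambda>i. f i t) (l t)"
  proof -
    \<comment> \<open>Each component vanishes near 0, so its transform is 0; by
      \<open>series\<close> these transforms are the entries of the linear form.\<close>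
    have "dt (\<lambda>t. power_flow_map nw (\<lambda>i. e i t) (\<lambda>i. f i t) (l t) $ r) k = 0"
      if "r < 2 * nbus nw" for r
      by (rule dt_eventually_0, rule eventually_mono[OF zero]) (metis index_zero_vec(1) that)
    then show ?thesis
      unfolding series[symmetric] by (intro eq_vecI) auto
  qed
  show ?thesis
    using series system solution coefficients_cong[OF assms(1,7)] by blast
qed

end
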